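(* Let $\mathcal{P}$ be a finite lattice, regarded as a category. Then the assignment $$\mathcal{R} \longleftrightarrow ({}^{\square} \mathcal{R},\mathcal{R})$$ gives an isomorphism between the poset of transfer systems on $\mathcal{P}$ and the poset of weak factorization systems on $\mathcal{P}$.
   Context: A poset $(\mathcal{P},\leq)$ is regarded as a category whose objects are its elements, with a unique morphism $x\to y$ when $x\leq y$ and none otherwise; a relation refining $\leq$ is identified with the corresponding collection of morphisms. A transfer system on a poset $\mathcal{P}$ is a partial order $\mathcal{R}$ on (the underlying set of) $\mathcal{P}$ that refines $\leq$ (i.e. $x\,\mathcal{R}\,y$ implies $x\leq y$) and such that for all $x,y,z\in\mathcal{P}$, if $x\,\mathcal{R}\,y$, $z\leq y$, and the meet $x\wedge z$ exists, then $(x\wedge z)\,\mathcal{R}\,z$. The set of transfer systems on $\mathcal{P}$ is partially ordered by refinement (inclusion of relations). A morphism $i\colon A\to B$ has the left lifting property with respect to $p\colon X\to Y$ (equivalently $p$ has the right lifting property with respect to $i$) if for every commutative square $pg=fi$ with $g\colon A\to X$, $f\colon B\to Y$, there is $\lambda\colon B\to X$ with $\lambda i=g$ and $p\lambda=f$. For a class $\mathcal{M}$ of morphisms, ${}^{\square}\mathcal{M}$ (resp. $\mathcal{M}^{\square}$) is the class of morphisms having the left (resp. right) lifting property with respect to all morphisms in $\mathcal{M}$. A weak factorization system in a category $\mathcal{C}$ is a pair $(\mathcal{L},\mathcal{R})$ of classes of morphisms such that (1) every morphism $f$ factors as $f=pi$ with $i\in\mathcal{L}$, $p\in\mathcal{R}$,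 and (2) $\mathcal{L}={}^{\square}\mathcal{R}$ and $\mathcal{R}=\mathcal{L}^{\square}$. Weak factorization systems on $\mathcal{C}$ are partially ordered by inclusion of the right class $\mathcal{R}$ (equivalently, reverse inclusion of the left class $\mathcal{L}$). *)

theory Defs
  imports Main
begin

section \<open>Categories, lifting properties and weak factorization systems\<close>

record ('o, 'm) cat =
  Obj :: "'o set"
  Mor :: "'m set"
  Dom :: "'m \<Rightarrow> 'o"
  Cod :: "'m \<Rightarrow> 'o"
  Ident :: "'o \<Rightarrow> 'm"
  Comp :: "'m \<Rightarrow> 'm \<Rightarrow> 'm"  \<comment> \<open>\<open>Comp C g f\<close> is the composite "first \<open>f\<close>, then \<open>g\<close>"\<close>

definition Hom :: "('o, 'm) cat \<Rightarrow> 'o \<Rightarrow> 'o \<Rightarrow> 'm set" where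
  "Hom C A B = {f \<in> Mor C. Dom C f = A \<and> Cod C f = B}"

definition is_category :: "('o, 'm) cat \<Rightarrow> bool" where
  "is_category C \<longleftrightarrow>
     (\<forall>f \<in> Mor C. Dom C f \<in> Obj C \<and> Cod C f \<in> Obj C) \<and>
     (\<forall>A \<in> Obj C. Ident C A \<in> Hom C A A) \<and>
     (\<forall>f \<in> Mor C. \<forall>g \<in> Mor C. Cod C f = Dom C g \<longrightarrow> Comp C g f \<in> Hom C (Dom C f) (Cod C g)) \<and>
     (\<forall>f \<in> Mor C. Comp C f (Ident C (Dom C f)) = f \<and> Comp C (Ident C (Cod C f)) f = f) \<and>
     (\<forall>f \<in> Mor C. \<forall>g \<in> Mor C. \<forall>h \<in> Mor C. Cod C f = Dom C g \<and> Cod C g = Dom C h \<longrightarrow>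
        Comp C h (Comp C g f) = Comp C (Comp C h g) f)"

definition has_lifting :: "('o, 'm) cat \<Rightarrow> 'm \<Rightarrow> 'm \<Rightarrow> bool" where
  "has_lifting C i p \<longleftrightarrow>
     (\<forall>g \<in> Hom C (Dom C i) (Dom C p). \<forall>f \<in> Hom C (Cod C i) (Cod C p).
        Comp C p g = Comp C f i \<longrightarrow>
        (\<exists>l \<in> Hom C (Cod C i) (Dom C p). Comp C l i = g \<and> Comp C p l = f))"

definition left_lifting_class :: "('o, 'm) cat \<Rightarrow> 'm set \<Rightarrow> 'm set" where
  "left_lifting_class C M = {i \<in> Mor C. \<forall>p \<in> M. has_lifting C i p}"

definition right_lifting_class :: "('o, 'm) cat \<Rightarrow> 'm set \<Rightarrow> 'm set" where
  "right_lifting_class C M = {p \<in> Mor C. \<forall>i \<in> M. has_lifting C i p}"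

definition weak_factorization_system :: "('o, 'm) cat \<Rightarrow> 'm set \<times> 'm set \<Rightarrow> bool" where
  "weak_factorization_system C W \<longleftrightarrow> (case W of (L, R) \<Rightarrow>
     L \<subseteq> Mor C \<and> R \<subseteq> Mor C \<and>
     (\<forall>f \<in> Mor C. \<exists>i \<in> L. \<exists>p \<in> R. Cod C i = Dom C p \<and> f = Comp C p i) \<and>
     L = left_lifting_class C R \<and>
     R = right_lifting_class C L)"

definition wfs_le :: "'m set \<times> 'm set \<Rightarrow> 'm set \<times> 'm set \<Rightarrow> bool" where
  "wfs_le W W' \<longleftrightarrow> snd W \<subseteq> snd W'"

section \<open>Posets as categories and transfer systems\<close>

text \<open>The unique morphism from \<open>x\<close> to \<open>y\<close> is the pair \<open>(x, y)\<close>, so a relation refining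
  \<open>\<le>\<close>, as a set of pairs, literally is a set of morphisms.\<close>

definition poset_category :: "('a::order, 'a \<times> 'a) cat" where
  "poset_category = \<lparr>Obj = UNIV, Mor = {(x, y). x \<le> y}, Dom = fst, Cod = snd,
     Ident = (\<lambda>x. (x, x)), Comp = (\<lambda>g f. (fst f, snd g))\<rparr>"

lemma is_category_poset_category: "is_category poset_category"
  by (auto simp: is_category_def Hom_def poset_category_def)

definition is_meet :: "'a::order \<Rightarrow> 'a \<Rightarrow> 'a \<Rightarrow> bool" where
  "is_meet m x z \<longleftrightarrow> m \<le> x \<and> m \<le> z \<and> (\<forall>w. w \<le> x \<and> w \<le> z \<longrightarrow> w \<le> m)"

definition transfer_system :: "('a::order) rel \<Rightarrow> bool" where
  "transfer_system R \<longleftrightarrow>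
     partial_order_on UNIV R \<and>
     (\<forall>x y. (x, y) \<in> R \<longrightarrow> x \<le> y) \<and>
     (\<forall>x y z m. (x, y) \<in> R \<and> z \<le> y \<and> is_meet m x z \<longrightarrow> (m, z) \<in> R)"

section \<open>Isomorphisms of posets\<close>

definition poset_isomorphism ::
  "'a set \<Rightarrow> ('a \<Rightarrow> 'a \<Rightarrow> bool) \<Rightarrow> 'b set \<Rightarrow> ('b \<Rightarrow> 'b \<Rightarrow> bool) \<Rightarrow> ('a \<Rightarrow> 'b) \<Rightarrow> bool" where
  "poset_isomorphism A leA B leB h \<longleftrightarrow>
     bij_betw h A B \<and> (\<forall>x \<in> A. \<forall>y \<in> A. leA x y \<longleftrightarrow> leB (h x) (h y))"

end

(* Lifting of a \<rightarrow> b against x \<rightarrow> y in a poset means: a \<le> x and b \<le> y imply b \<le> x. Right lifting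
   classes are therefore transfer systems. Conversely, for a transfer system R and a \<le> b, choose
   z minimal with a \<le> z and z R b; whenever x R y, a \<le> x and z \<le> y, restriction makes the meet of
   x and z another such element, so z \<le> x. Hence a \<rightarrow> z \<rightarrow> b is the required factorization, and the
   retract argument gives R as the right lifting class of its left lifting class. *)
theory Submission
  imports Defs
begin

lemma poset_category_simps [simp]:
  "Mor poset_category = {(x, y). x \<le> y}"
  "Dom poset_category = fst"
  "Cod poset_category = snd"
  "Comp poset_category g f = (fst f, snd g)"
  by (simp_all add: poset_category_def)

text \<open>Parallel morphisms in a poset are equal, so every square and both triangles commute. All
  that remains is whether the two horizontal sides and the diagonal from \<open>b\<close> to
  \<open>x\<close> exist.\<close>

lemma has_lifting_poset_category:
  assumes "a \<le> b" and "x \<le> y"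
  shows "has_lifting poset_category (a, b) (x, y) \<longleftrightarrow> (a \<le> x \<and> b \<le> y \<longrightarrow> b \<le> x)"
  using assms by (auto simp: has_lifting_def Hom_def)

lemma left_lifting_class_poset_category:
  assumes "R \<subseteq> {(x, y). x \<le> y}"
  shows "(a, b) \<in> left_lifting_class poset_category R \<longleftrightarrow>
    a \<le> b \<and> (\<forall>(x, y) \<in> R. a \<le> x \<and> b \<le> y \<longrightarrow> b \<le> x)"
  using assms by (fastforce simp: left_lifting_class_def has_lifting_poset_category)

lemma right_lifting_class_poset_category:
  assumes "L \<subseteq> {(x, y). x \<le> y}"
  shows "(x, y) \<in> right_lifting_class poset_category L \<longleftrightarrow>
    x \<le> y \<and> (\<forall>(a, b) \<in> L. a \<le> x \<and> b \<le> y \<longrightarrow> b \<le> x)"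
  using assms by (fastforce simp: right_lifting_class_def has_lifting_poset_category)

text \<open>Right lifting classes are stable under composition and pullback. Restriction is the
  pullback case: when \<open>m\<close> is a meet of \<open>x\<close> and \<open>z\<close>, the
  morphism \<open>(m, z)\<close> is the pullback of \<open>(x, y)\<close> along
  \<open>(z, y)\<close>.\<close>

lemma transfer_system_right_lifting_class:
  fixes L :: "('a::order) rel"
  assumes "L \<subseteq> {(x, y). x \<le> y}"
  shows "transfer_system (right_lifting_class poset_category L)"
proof -
  let ?R = "right_lifting_class poset_category L"
  note mem = right_lifting_class_poset_category[OF assms]
  have lift: "b \<le> x" if "(x, y) \<in> ?R" "(a, b) \<in> L" "a \<le> x" "b \<le> y" for a b x y
    using that by (auto simp: mem)
  have refl: "refl ?R"
    by (auto simp: refl_on_def mem)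
  have antisym: "antisym ?R"
    by (auto intro!: antisymI order_antisym simp: mem)
  have trans: "trans ?R"
  proof (rule transI)
    fix x y z assume xy: "(x, y) \<in> ?R" and yz: "(y, z) \<in> ?R"
    have "x \<le> y" "y \<le> z"
      using xy yz by (simp_all add: mem)
    \<comment> \<open>Lift in two stages: against \<open>(y, z)\<close> to get
      \<open>b \<le> y\<close>, then against \<open>(x, y)\<close>.\<close>
    moreover have "b \<le> x" if "(a, b) \<in> L" "a \<le> x" "b \<le> z" for a b
      using lift[OF xy] lift[OF yz] that order_trans[OF \<open>a \<le> x\<close> \<open>x \<le> y\<close>] by simp
    ultimately show "(x, z) \<in> ?R"
      by (auto simp: mem)
  qed
  have restrict: "(m, z) \<in> ?R"
    if xy: "(x, y) \<in> ?R" and "z \<le> y" and m: "is_meet m x z" for x y z m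
  proof -
    have "m \<le> x" "m \<le> z"
      using m by (simp_all add: is_meet_def)
    \<comment> \<open>Pasting with the pullback square gives a lift \<open>b \<le> x\<close>; the
      universal property of the meet turns it into \<open>b \<le> m\<close>.\<close>
    moreover have "b \<le> m" if ab: "(a, b) \<in> L" and "a \<le> m" "b \<le> z" for a b
    proof -
      have "b \<le> x"
        using lift[OF xy ab] order_trans[OF \<open>a \<le> m\<close> \<open>m \<le> x\<close>] order_trans[OF \<open>b \<le> z\<close> \<open>z \<le> y\<close>]
        by simp
      with m \<open>b \<le> z\<close> show ?thesis
        by (simp add: is_meet_def)
    qed
    ultimately show ?thesis
      by (auto simp: mem)
  qed
  show ?thesis
    unfolding transfer_system_def partial_order_on_def preorder_on_def
  proof (intro conjI allI impI)
    show "?R \<subseteq> UNIV \<times> UNIV"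
      by simp
    show "x \<le> y" if "(x, y) \<in> ?R" for x y
      using that by (simp add: mem)
    show "(m, z) \<in> ?R" if "(x, y) \<in> ?R \<and> z \<le> y \<and> is_meet m x z" for x y z m
      using that by (elim conjE) (rule restrict)
  qed (fact refl trans antisym)+
qed

lemma transfer_system_subset: "transfer_system R \<Longrightarrow> R \<subseteq> {(x, y). x \<le> y}"
  unfolding transfer_system_def by blast

lemma transfer_system_inf:
  fixes x y z :: "'a::lattice"
  assumes "transfer_system R" "(x, y) \<in> R" "z \<le> y"
  shows "(inf x z, z) \<in> R"
proof -
  have "is_meet (inf x z) x z"
    by (simp add: is_meet_def)
  with assms show ?thesis
    unfolding transfer_system_def by blast
qed

lemma transfer_system_factorization:
  fixes a b :: "'a::{finite, lattice}"
  assumes R: "transfer_system R" and "a \<le> b"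
  obtains z where "(a, z) \<in> left_lifting_class poset_category R" "(z, b) \<in> R"
proof -
  note le = transfer_system_subset[OF R]
  have "refl R" "trans R"
    using R unfolding transfer_system_def partial_order_on_def preorder_on_def by blast+
  let ?S = "{z. a \<le> z \<and> (z, b) \<in> R}"
  have "b \<in> ?S"
    using \<open>a \<le> b\<close> \<open>refl R\<close> by (simp add: refl_onD)
  then have "?S \<noteq> {}"
    by blast
  from finite_has_minimal[OF finite this]
  obtain z where z: "z \<in> ?S" and min: "\<forall>w \<in> ?S. w \<le> z \<longrightarrow> z = w"
    by (rule bexE)
  \<comment> \<open>This is the lifting condition that puts \<open>(a, z)\<close> in the left
    class.\<close>
  have "z \<le> x" if xy: "(x, y) \<in> R" and "a \<le> x" "z \<le> y" for x y
  proof -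
    have "(inf x z, z) \<in> R"
      using transfer_system_inf[OF R xy \<open>z \<le> y\<close>] .
    \<comment> \<open>\<open>a\<close> is below both \<open>x\<close> and \<open>z\<close>, and
      transitivity through \<open>z\<close> relates \<open>inf x z\<close> to
      \<open>b\<close>.\<close>
    then have "inf x z \<in> ?S"
      using z \<open>a \<le> x\<close> \<open>trans R\<close> by (auto dest: transD)
    from bspec[OF min this] have "z = inf x z"
      by simp
    then show ?thesis
      by (metis inf_le1)
  qed
  with z show ?thesis
    by (intro that[of z]) (auto simp: left_lifting_class_poset_category[OF le])
qed

lemma right_left_lifting_class_transfer_system:
  fixes R :: "('a::{finite, lattice}) rel"
  assumes R: "transfer_system R"
  shows "right_lifting_class poset_category (left_lifting_class poset_category R) = R"
proof -
  let ?L = "left_lifting_class poset_category R"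
  note le = transfer_system_subset[OF R]
  have L_le: "?L \<subseteq> {(x, y). x \<le> y}"
    by (auto simp: left_lifting_class_def)
  have "(x, y) \<in> R" if xy: "(x, y) \<in> right_lifting_class poset_category ?L" for x y
  proof -
    have "x \<le> y"
      using xy by (simp add: right_lifting_class_poset_category[OF L_le])
    then obtain z where z: "(x, z) \<in> ?L" "(z, y) \<in> R"
      using transfer_system_factorization[OF R] by blast
    then have "x \<le> z" "z \<le> y"
      using L_le le by auto
    \<comment> \<open>Retract argument: \<open>(x, y)\<close> lifts against its own left factor
      \<open>(x, z)\<close>, with the identity of \<open>x\<close> on top. Hence
      \<open>x = z\<close>, and \<open>(x, y)\<close> is the right factor.\<close>
    moreover from this z xy have "z \<le> x"
      by (auto simp: right_lifting_class_poset_category[OF L_le])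
    ultimately show ?thesis
      using z by (simp add: order_antisym)
  qed
  moreover have "R \<subseteq> right_lifting_class poset_category ?L"
    using le by (auto simp: right_lifting_class_def left_lifting_class_def)
  ultimately show ?thesis
    by auto
qed

lemma weak_factorization_system_transfer_system:
  fixes R :: "('a::{finite, lattice}) rel"
  assumes R: "transfer_system R"
  shows "weak_factorization_system poset_category (left_lifting_class poset_category R, R)"
proof -
  let ?L = "left_lifting_class poset_category R"
  have "\<exists>i \<in> ?L. \<exists>p \<in> R. snd i = fst p \<and> a = fst i \<and> b = snd p" if "a \<le> b" for a b
  proof -
    from transfer_system_factorization[OF R that]
    obtain z where "(a, z) \<in> ?L" "(z, b) \<in> R" .
    then show ?thesis
      by force
  qed
  moreover have "?L \<subseteq> {(x, y). x \<le> y}"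
    by (auto simp: left_lifting_class_def)
  moreover note transfer_system_subset[OF R]
  ultimately show ?thesis
    by (simp add: weak_factorization_system_def right_left_lifting_class_transfer_system[OF R])
qed

theorem theorem4p13:
  "poset_isomorphism
     {R :: ('a::{finite, lattice}) rel. transfer_system R} (\<subseteq>)
     {W. weak_factorization_system (poset_category :: ('a, 'a \<times> 'a) cat) W} wfs_le
     (\<lambda>R. (left_lifting_class poset_category R, R))"
proof -
  \<comment> \<open>Only surjectivity takes work: the map keeps \<open>R\<close> as second
    component, which is what \<open>wfs_le\<close> compares, so injectivity and both directions of
    monotonicity are immediate.\<close>
  have "W \<in> (\<lambda>R. (left_lifting_class poset_category R, R)) ` {R. transfer_system R}"
    if "weak_factorization_system poset_category W" for W :: "'a rel \<times> 'a rel"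
  proof -
    obtain L R where W: "W = (L, R)"
      by fastforce
    note wfs = that[unfolded W weak_factorization_system_def prod.case poset_category_simps]
    have L_le: "L \<subseteq> {(x, y). x \<le> y}"
      using wfs by (elim conjE)
    have L: "L = left_lifting_class poset_category R"
      using wfs by (elim conjE)
    have R: "R = right_lifting_class poset_category L"
      using wfs by (elim conjE)
    \<comment> \<open>\<open>R\<close> is a right lifting class, and \<open>L\<close> is determined
      by \<open>R\<close>, so \<open>W\<close> is the image of \<open>R\<close>.\<close>
    have "transfer_system R"
      by (subst R) (rule transfer_system_right_lifting_class[OF L_le])
    then show ?thesis
      unfolding W by (intro image_eqI[where x = R]) (simp_all add: L[symmetric])
  qed
  then show ?thesis
    by (auto simp: poset_isomorphism_def bij_betw_def inj_on_def wfs_le_def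
        weak_factorization_system_transfer_system)
qed

end
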